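(* For a real number $s$ define the coefficients $f_k(s)$, $k\ge0$, by $$\prod_{n\ge1}(1-x^n)^s=\sum_{k\ge0}f_k(s)\,x^k .$$ Let $k$ be a positive integer and $s$ be a real number such that $s>k-1$. Then $(-1)^k f_k(2s^2+s)>0$.
   Context: The product is expanded as a power series in $x$, with $(1-u)^s=\exp\left(-s\sum_{m\ge1}u^m/m\right)$. *)

theory Defs
  imports "HOL-Analysis.Infinite_Products" "HOL-Computational_Algebra.Formal_Power_Series"
begin

text \<open>The formal power series $(1-u)^s = \exp\bigl(-s\sum_{m\ge1}u^m/m\bigr)$ in $u$.\<close>

definition one_minus_pow :: "real \<Rightarrow> real fps" where
  "one_minus_pow s =
     fps_exp 1 oo (fps_const (- s) * Abs_fps (\<lambda>m. if m = 0 then 0 else 1 / real m))"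

text \<open>
  The infinite product is taken with respect to the library's metric on formal power series, in
  which convergence is eventual constancy of each coefficient.  Library products start at index
  \<open>0\<close>, so \<open>\<Prod>\<^sub>n\<^sub>\<ge>\<^sub>1\<close> is written with \<open>Suc n\<close>.
\<close>

definition eta_pow :: "real \<Rightarrow> real fps" where
  "eta_pow s = (\<Prod>n. one_minus_pow s oo fps_X ^ Suc n)"

definition eta_coeff :: "nat \<Rightarrow> real \<Rightarrow> real" where
  "eta_coeff k s = fps_nth (eta_pow s) k"

text \<open>
  \<open>prodinf\<close> is unspecified for a divergent product; the following rules this out.
\<close>

lemma one_minus_pow_nth_0: "fps_nth (one_minus_pow s) 0 = 1"
  by (simp add: one_minus_pow_def fps_compose_nth)

lemma compose_X_power_nth:
  fixes E :: "real fps"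
  assumes "fps_nth E 0 = 1" and "j \<le> n"
  shows "fps_nth (E oo fps_X ^ Suc n) j = (if j = 0 then 1 else 0)"
proof -
  have "fps_nth (E oo fps_X ^ Suc n) j
      = (\<Sum>i=0..j. fps_nth E i * (if j = Suc n * i then 1 else 0))"
    by (simp only: fps_compose_nth power_mult [symmetric] fps_X_power_nth)
  also have "\<dots> = (\<Sum>i=0..j. if i = 0 then (if j = 0 then 1 else 0) else 0)"
  proof (rule sum.cong)
    fix i
    have "j \<noteq> Suc n * i" if "i > 0"
    proof -
      have "Suc n \<le> Suc n * i" using that by (cases i) auto
      with \<open>j \<le> n\<close> show ?thesis by (metis Suc_n_not_le_n le_trans)
    qed
    then show "fps_nth E i * (if j = Suc n * i then 1 else 0)
        = (if i = 0 then (if j = 0 then 1 else 0) else 0)"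
      using assms by (cases "i = 0") (simp_all del: mult_Suc)
  qed simp
  finally show ?thesis by simp
qed

lemma has_prod_eta_pow: "(\<lambda>n. one_minus_pow s oo fps_X ^ Suc n) has_prod eta_pow s"
proof -
  define F where "F = (\<lambda>n. one_minus_pow s oo fps_X ^ Suc n)"
  define P where "P = (\<lambda>N. \<Prod>i\<le>N. F i)"
  define Q where "Q = Abs_fps (\<lambda>j. fps_nth (P j) j)"
  have F: "fps_nth (F n) j = (if j = 0 then 1 else 0)" if "j \<le> n" for n j
    unfolding F_def by (rule compose_X_power_nth [OF one_minus_pow_nth_0 that])
  have step: "fps_nth (P (Suc N)) j = fps_nth (P N) j" if "j \<le> Suc N" for N j
  proof -
    have "fps_nth (P (Suc N)) j = (\<Sum>i=0..j. fps_nth (P N) i * fps_nth (F (Suc N)) (j - i))"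
      by (simp add: P_def fps_mult_nth)
    also have "\<dots> = (\<Sum>i=0..j. if i = j then fps_nth (P N) j else 0)"
      by (rule sum.cong) (use that F in auto)
    finally show ?thesis by simp
  qed
  have stable: "fps_nth (P N) j = fps_nth (P j) j" if "j \<le> N" for N j
    using that by (induction N rule: dec_induct) (simp_all only: step le_SucI)
  have lim: "P \<longlonglongrightarrow> Q"
    unfolding tendsto_fps_iff
  proof
    fix j
    show "\<forall>\<^sub>F N in sequentially. fps_nth (P N) j = fps_nth Q j"
      using eventually_ge_at_top [of j]
      by eventually_elim (simp only: Q_def fps_nth_Abs_fps, rule stable)
  qed
  have "fps_nth Q 0 = 1"
    using F [of 0 0] by (simp add: Q_def P_def)
  then have "Q \<noteq> 0" by auto
  with lim have "F has_prod Q"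
    by (simp add: has_prod_def raw_has_prod_def P_def)
  moreover from this have "eta_pow s = Q"
    unfolding eta_pow_def F_def [symmetric] by (rule has_prod_unique [symmetric])
  ultimately show ?thesis
    unfolding F_def by (simp only:)
qed

end

theory Submission
  imports Defs
begin

text \<open>
  Put $t = 2s^2+s$ and $g_j = (-1)^j f_j(t)$.  Logarithmic differentiation of the product gives
  $j g_j = t\,(g_{j-1} - 3 g_{j-2} + 4 g_{j-3} - 7 g_{j-4} + \cdots)$, the coefficients being
  divisor sums.  The hypothesis on $s$ only enters through $t > (k-1)(2k-1)$.  For such $t$ the
  ratios $g_j/g_{j-1}$ with $j \le k$ stay so large, once $k \ge 6$, that the terms after the first
  two can be paired off with a nonnegative total; what is left is
  $j g_j \ge t\,(g_{j-1} - 3 g_{j-2})$, which propagates a lower bound for the ratios.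
  For $k \le 5$ the polynomials $f_k$ are explicit.
\<close>

section \<open>Divisor sums sigma(m) and crude bounds for them\<close>

definition divisor_sum :: "nat \<Rightarrow> real" where
  "divisor_sum m = (\<Sum>d=1..m. if d dvd m then real d else 0)"

lemma divisor_sum_nonneg: "0 \<le> divisor_sum m"
  unfolding divisor_sum_def by (intro sum_nonneg) auto

text \<open>Counting every number up to m is crude, and so is counting only the divisors 1 and m in
  the next lemma. Together they still bound sigma(m+1)/sigma(m) by (m+2)/2 for m > 1, which is all
  the pairing argument needs.\<close>

lemma divisor_sum_le: "divisor_sum m \<le> real m * (real m + 1) / 2"
proof -
  have "divisor_sum m \<le> (\<Sum>d=1..m. real d)"
    unfolding divisor_sum_def by (intro sum_mono) auto
  also have "\<dots> = real m * (real m + 1) / 2"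
    by (induction m) (auto simp: field_simps)
  finally show ?thesis .
qed

lemma divisor_sum_ge:
  assumes "m > 1"
  shows "real m + 1 \<le> divisor_sum m"
proof -
  have "(\<Sum>d\<in>{1, m}. if d dvd m then real d else 0) \<le> divisor_sum m"
    unfolding divisor_sum_def using assms by (intro sum_mono2) auto
  then show ?thesis using assms by simp
qed

section \<open>Logarithmic differentiation of the product\<close>

lemma one_minus_pow_deriv:
  "fps_X * fps_deriv (one_minus_pow t)
    = fps_const (- t) * one_minus_pow t * Abs_fps (\<lambda>m. if m = 0 then 0 else 1)"
proof -
  define L :: "real fps" where "L = Abs_fps (\<lambda>m. if m = 0 then 0 else 1 / real m)"
  \<comment> \<open>The right-hand side is x/(1-x).\<close>
  have "fps_X * fps_deriv L = Abs_fps (\<lambda>m. if m = 0 then 0 else 1)"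
    by (rule fps_ext) (auto simp: L_def)
  moreover have "fps_deriv (one_minus_pow t) = one_minus_pow t * (fps_const (- t) * fps_deriv L)"
    unfolding one_minus_pow_def L_def [symmetric]
    by (subst fps_compose_deriv) (simp_all add: L_def)
  ultimately show ?thesis
    by (metis mult.assoc mult.left_commute)
qed

text \<open>Chain rule: the operator x d/dx multiplies x^n by n, so
  \<open>one_minus_pow_deriv\<close> is evaluated at x^n with an extra factor n. The last series is
  n x^n/(1-x^n).\<close>

lemma one_minus_pow_compose_deriv:
  assumes "n > 0"
  shows "fps_X * fps_deriv (one_minus_pow t oo fps_X ^ n)
    = fps_const (- t) * (one_minus_pow t oo fps_X ^ n)
        * Abs_fps (\<lambda>m. if m > 0 \<and> n dvd m then real n else 0)"
proof -
  define E where "E = one_minus_pow t"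
  define H :: "real fps" where "H = Abs_fps (\<lambda>m. if m = 0 then 0 else 1)"
  define Xn :: "real fps" where "Xn = fps_X ^ n"
  have Xn0: "fps_nth Xn 0 = 0" using assms by (simp add: Xn_def)
  have "fps_X * fps_deriv Xn = fps_const (real n) * Xn"
  proof (rule fps_ext)
    fix m
    show "fps_nth (fps_X * fps_deriv Xn) m = fps_nth (fps_const (real n) * Xn) m"
      using assms by (cases m) (auto simp: Xn_def)
  qed
  then have "fps_X * fps_deriv (E oo Xn) = fps_const (real n) * (Xn * (fps_deriv E oo Xn))"
    by (simp add: fps_compose_deriv Xn0 mult_ac)
  also have "Xn * (fps_deriv E oo Xn) = (fps_X * fps_deriv E) oo Xn"
    by (simp add: fps_compose_mult_distrib Xn0)
  also have "\<dots> = (fps_const (- t) * E * H) oo Xn"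
    unfolding E_def H_def one_minus_pow_deriv ..
  also have "\<dots> = fps_const (- t) * (E oo Xn) * (H oo Xn)"
    by (simp add: fps_compose_mult_distrib Xn0)
  also have "fps_const (real n) * (fps_const (- t) * (E oo Xn) * (H oo Xn))
      = fps_const (- t) * (E oo Xn) * (fps_const (real n) * (H oo Xn))"
    by (simp only: mult_ac)
  also have "fps_const (real n) * (H oo Xn) = Abs_fps (\<lambda>m. if m > 0 \<and> n dvd m then real n else 0)"
  proof (rule fps_ext)
    fix m
    have "fps_nth (H oo Xn) m = (\<Sum>i=0..m. if m = n * i \<and> i > 0 then 1 else 0)"
      by (auto simp: fps_compose_nth Xn_def H_def power_mult [symmetric] intro!: sum.cong)
    also have "\<dots> = (if m > 0 \<and> n dvd m then 1 else 0)"
    proof (cases "m > 0 \<and> n dvd m")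
      case True
      then obtain q where q: "m = n * q" "q > 0" by (auto elim: dvdE)
      then have "q \<le> m" using assms by simp
      have "(\<Sum>i=0..m. if m = n * i \<and> i > 0 then 1 else 0)
          = (\<Sum>i=0..m. if i = q then 1 else (0::real))"
        using q assms by (intro sum.cong) auto
      with \<open>q \<le> m\<close> True show ?thesis by simp
    next
      case False
      then have "(\<Sum>i=0..m. if m = n * i \<and> i > 0 then 1 else 0) = (0::real)"
        using assms by (intro sum.neutral) auto
      with False show ?thesis by auto
    qed
    finally show "fps_nth (fps_const (real n) * (H oo Xn)) m
        = fps_nth (Abs_fps (\<lambda>m. if m > 0 \<and> n dvd m then real n else 0)) m"
      by simp
  qed
  finally show ?thesis by (simp add: E_def Xn_def)
qed

text \<open>Logarithmic derivatives add under products; the division-free form needs no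
  invertibility of the factors.\<close>

lemma fps_log_deriv_prod:
  fixes F :: "'b \<Rightarrow> 'a::comm_ring_1 fps"
  assumes "\<And>i. i \<in> A \<Longrightarrow> fps_X * fps_deriv (F i) = c * F i * S i"
  shows "fps_X * fps_deriv (\<Prod>i\<in>A. F i) = c * (\<Prod>i\<in>A. F i) * (\<Sum>i\<in>A. S i)"
  using assms
proof (induction A rule: infinite_finite_induct)
  case (insert x A)
  have "fps_X * fps_deriv (F x * prod F A)
      = F x * (fps_X * fps_deriv (prod F A)) + (fps_X * fps_deriv (F x)) * prod F A"
    by (simp add: algebra_simps)
  also have "\<dots> = c * (F x * prod F A) * (S x + sum S A)"
    using insert by (simp add: algebra_simps)
  finally show ?case using insert by simp
qed simp_all

lemma eventually_partial_prod_nth: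
  "\<forall>\<^sub>F N in sequentially.
    fps_nth (\<Prod>i\<le>N. one_minus_pow t oo fps_X ^ Suc i) j = eta_coeff j t"
  using has_prod_imp_tendsto [OF has_prod_eta_pow [of t]]
  by (simp only: tendsto_fps_iff eta_coeff_def)

text \<open>A single partial product suffices: its index N is taken so large that the coefficients
  up to j have settled, and at least j, so that every divisor of every m <= j appears among the
  factors.\<close>

lemma eta_coeff_recurrence:
  "real j * eta_coeff j t = - t * (\<Sum>i=0..j. eta_coeff i t * divisor_sum (j - i))"
proof -
  define F where "F = (\<lambda>n. one_minus_pow t oo fps_X ^ Suc n)"
  define P where "P = (\<lambda>N. \<Prod>i\<le>N. F i)"
  define S where "S = (\<lambda>n. Abs_fps (\<lambda>m. if m > 0 \<and> Suc n dvd m then real (Suc n) else 0))"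
  have "\<forall>i\<in>{..j}. \<forall>\<^sub>F N in sequentially. fps_nth (P N) i = eta_coeff i t"
    unfolding P_def F_def using eventually_partial_prod_nth by blast
  then have "\<forall>\<^sub>F N in sequentially. \<forall>i\<in>{..j}. fps_nth (P N) i = eta_coeff i t"
    by (intro eventually_ball_finite) auto
  then have "\<forall>\<^sub>F N in sequentially. j \<le> N \<and> (\<forall>i\<in>{..j}. fps_nth (P N) i = eta_coeff i t)"
    using eventually_ge_at_top eventually_conj by blast
  then obtain N where "j \<le> N" and P: "\<And>i. i \<le> j \<Longrightarrow> fps_nth (P N) i = eta_coeff i t"
    by (auto simp: eventually_sequentially)
  have S: "fps_nth (\<Sum>n\<le>N. S n) m = divisor_sum m" if "m \<le> j" for m
  proof -
    have "fps_nth (\<Sum>n\<le>N. S n) m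
        = (\<Sum>n\<le>N. if m > 0 \<and> Suc n dvd m then real (Suc n) else 0)"
      by (simp add: fps_sum_nth S_def)
    also have "\<dots> = (\<Sum>d=1..Suc N. if m > 0 \<and> d dvd m then real d else 0)"
      by (rule sum.reindex_bij_witness [of _ "\<lambda>d. d - 1" Suc]) auto
    also have "\<dots> = divisor_sum m"
      unfolding divisor_sum_def using that \<open>j \<le> N\<close>
      by (intro sum.mono_neutral_cong_right) (auto dest: dvd_imp_le)
    finally show ?thesis .
  qed
  have "fps_X * fps_deriv (P N) = fps_const (- t) * P N * (\<Sum>n\<le>N. S n)"
    unfolding P_def S_def F_def
    by (intro fps_log_deriv_prod one_minus_pow_compose_deriv) simp
  then have "fps_nth (fps_X * fps_deriv (P N)) j
      = fps_nth (fps_const (- t) * (P N * (\<Sum>n\<le>N. S n))) j"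
    by (simp only: mult.assoc)
  moreover have "fps_nth (fps_X * fps_deriv (P N)) j = real j * fps_nth (P N) j"
    by (cases j) auto
  moreover have "fps_nth (fps_const (- t) * (P N * (\<Sum>n\<le>N. S n))) j
      = - t * (\<Sum>i=0..j. fps_nth (P N) i * fps_nth (\<Sum>n\<le>N. S n) (j - i))"
    by (simp only: mult.assoc fps_mult_left_const_nth) (simp add: fps_mult_nth)
  ultimately show ?thesis
    using P S by simp
qed

lemma eta_coeff_0: "eta_coeff 0 t = 1"
proof -
  obtain N where "fps_nth (\<Prod>i\<le>N. one_minus_pow t oo fps_X ^ Suc i) 0 = eta_coeff 0 t"
    using eventually_partial_prod_nth [of t 0] by (auto simp: eventually_sequentially)
  moreover have "fps_nth (\<Prod>i\<le>N. one_minus_pow t oo fps_X ^ Suc i) 0 = 1"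
    by (induction N) (simp_all add: fps_compose_nth one_minus_pow_nth_0)
  ultimately show ?thesis by simp
qed

section \<open>The sign-adjusted recurrence and the ratio bound\<close>

definition signed_coeff :: "real \<Rightarrow> nat \<Rightarrow> real" where
  "signed_coeff t j = (- 1) ^ j * eta_coeff j t"

lemma signed_coeff_0: "signed_coeff t 0 = 1"
  by (simp add: signed_coeff_def eta_coeff_0)

lemma signed_coeff_Suc:
  "real (Suc n) * signed_coeff t (Suc n)
    = t * (\<Sum>l\<le>n. (- 1) ^ l * (divisor_sum (Suc l) * signed_coeff t (n - l)))"
proof -
  \<comment> \<open>This removes the term i = j from the recurrence, leaving only earlier
    coefficients on the right.\<close>
  have d0: "divisor_sum 0 = 0" by (simp add: divisor_sum_def)
  have "real (Suc n) * signed_coeff t (Suc n)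
      = (- 1) ^ Suc n * (- t * (\<Sum>i=0..Suc n. eta_coeff i t * divisor_sum (Suc n - i)))"
    unfolding signed_coeff_def eta_coeff_recurrence [symmetric] by simp
  also have "\<dots> = t * (\<Sum>i\<le>n. (- 1) ^ n * (eta_coeff i t * divisor_sum (Suc n - i)))"
    by (simp add: d0 sum_distrib_left atMost_atLeast0 mult_ac)
  also have "(\<Sum>i\<le>n. (- 1) ^ n * (eta_coeff i t * divisor_sum (Suc n - i)))
      = (\<Sum>l\<le>n. (- 1) ^ l * (divisor_sum (Suc l) * signed_coeff t (n - l)))"
  proof (rule sum.reindex_bij_witness [of _ "\<lambda>l. n - l" "\<lambda>i. n - i"])
    fix i assume "i \<in> {..n}"
    then have "(- 1) ^ n = (- 1) ^ (n - i) * ((- 1 :: real) ^ i)"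
      by (simp add: power_add [symmetric])
    with \<open>i \<in> {..n}\<close> show "(- 1) ^ (n - i) * (divisor_sum (Suc (n - i)) * signed_coeff t (n - (n - i)))
        = (- 1) ^ n * (eta_coeff i t * divisor_sum (Suc n - i))"
      by (simp add: signed_coeff_def Suc_diff_le mult_ac)
  qed auto
  finally show ?thesis .
qed

text \<open>Terms 2i and 2i+1 are paired; for even n the last term stays alone and is nonnegative.
  Hence comparisons are needed only within pairs.\<close>

lemma alternating_sum_nonneg:
  fixes b :: "nat \<Rightarrow> real"
  assumes "\<And>l. l \<le> n \<Longrightarrow> 0 \<le> b l"
    and "\<And>l. even l \<Longrightarrow> Suc l \<le> n \<Longrightarrow> b (Suc l) \<le> b l"
  shows "0 \<le> (\<Sum>l\<le>n. (- 1) ^ l * b l)"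
  using assms
proof (induction n rule: induct_nat_012)
  case (ge2 n)
  have IH: "0 \<le> (\<Sum>l\<le>n. (- 1) ^ l * b l)"
    by (rule ge2.IH) (use ge2.prems in auto)
  show ?case
  proof (cases "even n")
    case True
    have "0 \<le> (\<Sum>l\<le>Suc n. (- 1) ^ l * b l)"
      by (rule ge2.IH) (use ge2.prems in auto)
    with True ge2.prems(1) [of "Suc (Suc n)"] show ?thesis by simp
  next
    case False
    with IH ge2.prems(2) [of "Suc n"] show ?thesis by simp
  qed
qed (use assms in auto)

text \<open>
  The linear term and the factor \<open>6\<close> are chosen so that the bound reproduces itself under the
  recurrence as soon as \<open>t \<ge> 12 (k - 2)\<close>; the ratio it yields exceeds \<open>(k + 1) / 2\<close>, which
  dominates every quotient of consecutive divisor sums occurring up to index \<open>k\<close>.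
\<close>

lemma signed_coeff_ratio:
  assumes k: "6 \<le> k" and t: "(real k - 1) * (2 * real k - 1) < t" and "j < k"
  shows "0 < signed_coeff t j
    \<and> (t - 6 * real j) * signed_coeff t j \<le> real (Suc j) * signed_coeff t (Suc j)"
  using \<open>j < k\<close>
proof (induction j rule: less_induct)
  case (less n)
  define g where "g = signed_coeff t"
  have k6: "6 \<le> real k" using k by simp
  have step: "(real k + 1) / 2 * g i \<le> g (Suc i)" "0 < g i" "0 < g (Suc i)" if "i < n" for i
  proof -
    have IH: "0 < g i" "(t - 6 * real i) * g i \<le> real (Suc i) * g (Suc i)"
      using less.IH [of i] that less.prems by (simp_all add: g_def)
    have ik: "real (Suc i) \<le> real k" using that less.prems by linarith
    have "real (Suc i) * ((real k + 1) / 2) \<le> real k * ((real k + 1) / 2)"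
      using ik by (intro mult_right_mono) auto
    \<comment> \<open>Twice the difference of the two sides is (k-6)(3k-1) + 8. At k = 5 it would be
      negative, hence the bound 6 on k.\<close>
    also have "\<dots> \<le> (real k - 1) * (2 * real k - 1) - 6 * (real k - 1)"
      using mult_nonneg_nonneg [of "real k - 6" "3 * real k - 1"] k6
      by (simp add: field_simps)
    also have "\<dots> \<le> t - 6 * real i"
      using t ik by simp
    finally have "real (Suc i) * ((real k + 1) / 2) * g i \<le> (t - 6 * real i) * g i"
      using IH by (intro mult_right_mono) auto
    with IH have "real (Suc i) * ((real k + 1) / 2 * g i) \<le> real (Suc i) * g (Suc i)"
      by (simp only: mult.assoc)
    then show *: "(real k + 1) / 2 * g i \<le> g (Suc i)"
      by (simp only: mult_le_cancel_left_pos of_nat_0_less_iff zero_less_Suc)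
    show "0 < g i" by fact
    then have "0 < (real k + 1) / 2 * g i" by simp
    with * show "0 < g (Suc i)" by linarith
  qed
  have gpos: "0 < g i" if "i \<le> n" for i
    using that step(3) [of "i - 1"] by (cases i) (auto simp: g_def signed_coeff_0)
  have "0 \<le> (real k - 1) * (2 * real k - 1)"
    using k6 by (intro mult_nonneg_nonneg) auto
  with t have t0: "0 < t" by linarith
  have "(t - 6 * real n) * g n \<le> real (Suc n) * g (Suc n)"
  proof (cases n)
    case 0
    then show ?thesis
      using signed_coeff_Suc [of 0 t] by (simp add: g_def divisor_sum_def)
  next
    case (Suc m)
    define b where "b = (\<lambda>l. divisor_sum (Suc l) * g (n - l))"
    have d: "divisor_sum 1 = 1" "divisor_sum 2 = 3"
      by (simp_all add: divisor_sum_def numeral_2_eq_2)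
    \<comment> \<open>The tail 4 g(n-2) - 7 g(n-3) + ... begins with a plus sign, and a shift by 2
      preserves signs.\<close>
    have "- 1 * (\<Sum>l=2..n. (- 1) ^ l * b l) \<le> 0"
    proof (cases "n < 2")
      case False
      have "0 \<le> (\<Sum>l\<le>n-2. (- 1) ^ l * b (l + 2))"
      proof (rule alternating_sum_nonneg)
        fix l assume "l \<le> n - 2"
        with False show "0 \<le> b (l + 2)"
          unfolding b_def using gpos [of "n - (l + 2)"] divisor_sum_nonneg [of "Suc (l + 2)"]
          by (intro mult_nonneg_nonneg) auto
      next
        fix l assume "Suc l \<le> n - 2"
        define i where "i = n - (l + 3)"
        have arg: "Suc (Suc l + 2) = l + 4" "Suc (l + 2) = l + 3" "n - (Suc l + 2) = i"
          by (simp_all add: i_def)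
        have i: "n - (l + 2) = Suc i" "i < n" and lk: "l + 4 \<le> k"
          using \<open>Suc l \<le> n - 2\<close> less.prems by (auto simp: i_def)
        \<comment> \<open>The quotient sigma(l+4)/sigma(l+3) is at most (l+5)/2 <= (k+1)/2, which is
          below the ratio of \<open>g (Suc i)\<close> to \<open>g i\<close>.\<close>
        have "divisor_sum (l + 4) \<le> real (l + 4) * ((real (l + 4) + 1) / 2)"
          using divisor_sum_le [of "l + 4"] by simp
        also have "\<dots> \<le> divisor_sum (l + 3) * ((real k + 1) / 2)"
          using divisor_sum_ge [of "l + 3"] lk by (intro mult_mono) auto
        finally have "divisor_sum (l + 4) * g i \<le> divisor_sum (l + 3) * ((real k + 1) / 2) * g i"
          using step(2) [OF i(2)] by (intro mult_right_mono) auto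
        also have "\<dots> \<le> divisor_sum (l + 3) * g (Suc i)"
          unfolding mult.assoc
          using step(1) [OF i(2)] divisor_sum_nonneg by (intro mult_left_mono) auto
        finally show "b (Suc l + 2) \<le> b (l + 2)"
          unfolding b_def arg i(1) .
      qed
      also have "\<dots> = (\<Sum>l=2..n. (- 1) ^ l * b l)"
        by (rule sum.reindex_bij_witness [of _ "\<lambda>l. l - 2" "\<lambda>l. l + 2"]) (use False in auto)
      finally show ?thesis by simp
    qed simp
    moreover have "(\<Sum>l\<le>n. (- 1) ^ l * b l) = b 0 - b 1 + (\<Sum>l=2..n. (- 1) ^ l * b l)"
      using Suc by (simp add: atMost_atLeast0 sum.atLeast_Suc_atMost numeral_2_eq_2)
    moreover have "b 0 - b 1 = g n - 3 * g m"
      using d Suc by (simp add: b_def numeral_2_eq_2)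
    ultimately have "t * (g n - 3 * g m) \<le> t * (\<Sum>l\<le>n. (- 1) ^ l * b l)"
      using t0 by (intro mult_left_mono) auto
    also have "\<dots> = real (Suc n) * g (Suc n)"
      unfolding signed_coeff_Suc g_def b_def ..
    finally have low: "t * (g n - 3 * g m) \<le> real (Suc n) * g (Suc n)" .
    have IH: "(t - 6 * real m) * g m \<le> real n * g n"
      using less.IH [of m] less.prems Suc by (simp add: g_def)
    \<comment> \<open>Given \<open>low\<close>, the goal reduces to t g(m) <= 2n g(n). Doubling
      \<open>IH\<close> gives 2(t - 6m) g(m) <= 2n g(n), so t >= 12m is enough. Here m <= k-2, and
      (k-1)(2k-1) - 12(k-2) = (k-5)(2k-5).\<close>
    have "12 * real m \<le> 12 * (real k - 2)" using Suc less.prems by simp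
    also have "\<dots> \<le> (real k - 1) * (2 * real k - 1)"
      using mult_nonneg_nonneg [of "real k - 5" "2 * real k - 5"] k6
      by (simp add: algebra_simps)
    finally have "0 \<le> 3 * (t - 12 * real m)" using t by simp
    then have "0 \<le> 3 * (t - 12 * real m) * g m"
      using gpos [of m] Suc by (intro mult_nonneg_nonneg) auto
    with low IH show ?thesis by (simp add: algebra_simps)
  qed
  with gpos [of n] show ?case by (simp add: g_def)
qed

section \<open>Small indices and the conclusion\<close>

lemma signed_coeff_upto_5:
  shows "signed_coeff t (Suc 0) = t"
    and "signed_coeff t 2 = t * (t - 3) / 2"
    and "signed_coeff t 3 = t * (t - 1) * (t - 8) / 6"
    and "signed_coeff t 4 = t * (t - 1) * (t - 3) * (t - 14) / 24"
    and "signed_coeff t 5 = t * (t - 3) * (t - 6) * (t\<^sup>2 - 21 * t + 8) / 120"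
proof -
  have d: "divisor_sum 1 = 1" "divisor_sum 2 = 3" "divisor_sum 3 = 4"
    "divisor_sum 4 = 7" "divisor_sum 5 = 6"
  proof -
    have "{1..2::nat} = {1, 2}" "{1..3::nat} = {1, 2, 3}" "{1..4::nat} = {1, 2, 3, 4}"
      "{1..5::nat} = {1, 2, 3, 4, 5}"
      by auto
    then show "divisor_sum 1 = 1" "divisor_sum 2 = 3" "divisor_sum 3 = 4"
      "divisor_sum 4 = 7" "divisor_sum 5 = 6"
      unfolding divisor_sum_def by simp_all
  qed
  show 1: "signed_coeff t (Suc 0) = t"
    using signed_coeff_Suc [of 0 t] d by (simp add: signed_coeff_0)
  have "2 * signed_coeff t 2 = t * (signed_coeff t (Suc 0) - 3)"
    using signed_coeff_Suc [of 1 t] d by (simp add: signed_coeff_0 eval_nat_numeral)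
  then show 2: "signed_coeff t 2 = t * (t - 3) / 2"
    unfolding 1 by (simp add: field_simps power2_eq_square)
  have "3 * signed_coeff t 3 = t * (signed_coeff t 2 - 3 * signed_coeff t (Suc 0) + 4)"
    using signed_coeff_Suc [of 2 t] d by (simp add: signed_coeff_0 eval_nat_numeral)
  then show 3: "signed_coeff t 3 = t * (t - 1) * (t - 8) / 6"
    unfolding 1 2 by (simp add: field_simps power2_eq_square)
  have "4 * signed_coeff t 4 = t * (signed_coeff t 3 - 3 * signed_coeff t 2 + 4 * signed_coeff t (Suc 0) - 7)"
    using signed_coeff_Suc [of 3 t] d by (simp add: signed_coeff_0 eval_nat_numeral)
  then show 4: "signed_coeff t 4 = t * (t - 1) * (t - 3) * (t - 14) / 24"
    unfolding 1 2 3 by (simp add: field_simps power2_eq_square)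
  have "5 * signed_coeff t 5 = t * (signed_coeff t 4 - 3 * signed_coeff t 3 + 4 * signed_coeff t 2 - 7 * signed_coeff t (Suc 0) + 6)"
    using signed_coeff_Suc [of 4 t] d by (simp add: signed_coeff_0 eval_nat_numeral)
  then show "signed_coeff t 5 = t * (t - 3) * (t - 6) * (t\<^sup>2 - 21 * t + 8) / 120"
    unfolding 1 2 3 4 by (simp add: field_simps power2_eq_square)
qed

text \<open>For k = 1, ..., 5 the lower bound on t is 0, 3, 10, 21, 36, and no real root of the
  explicit polynomial exceeds it. For larger k the ratio bound at k-1 has a positive factor, since
  (k-1)(2k-1) - 6(k-1) = (k-1)(2k-7).\<close>

lemma signed_coeff_pos:
  assumes "0 < k" and t: "(real k - 1) * (2 * real k - 1) < t"
  shows "0 < signed_coeff t k"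
proof (cases "6 \<le> k")
  case True
  have "0 < signed_coeff t (k - 1)"
    and *: "(t - 6 * real (k - 1)) * signed_coeff t (k - 1) \<le> real k * signed_coeff t k"
    using signed_coeff_ratio [OF True t, of "k - 1"] True by auto
  moreover have "0 < t - 6 * real (k - 1)"
    using t True mult_nonneg_nonneg [of "real k - 1" "2 * real k - 7"]
    by (simp add: of_nat_diff algebra_simps)
  ultimately have "0 < real k * signed_coeff t k"
    by (meson less_le_trans mult_pos_pos)
  then show ?thesis using True by (simp add: zero_less_mult_iff)
next
  case False
  with \<open>0 < k\<close> consider "k = 1" | "k = 2" | "k = 3" | "k = 4" | "k = 5" by linarith
  then show ?thesis
  proof cases
    case 5
    have "0 < t * (t - 21)" using t 5 by (intro mult_pos_pos) auto
    then have "0 < t\<^sup>2 - 21 * t + 8" by (simp add: power2_eq_square algebra_simps)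
    with t 5 show ?thesis by (simp add: signed_coeff_upto_5)
  qed (use t in \<open>simp_all add: signed_coeff_upto_5\<close>)
qed

theorem theorem3p15:
  fixes k :: nat and s :: real
  assumes "k > 0" and "s > real k - 1"
  shows "(-1) ^ k * eta_coeff k (2 * s\<^sup>2 + s) > 0"
proof -
  \<comment> \<open>Both factors of 2s^2 + s = s(2s+1) increase strictly with s, and k-1 >= 0; the
    left side is the value at s = k-1.\<close>
  have "(real k - 1) * (2 * real k - 1) < s * (2 * s + 1)"
    using assms by (intro mult_strict_mono') auto
  then have "0 < signed_coeff (2 * s\<^sup>2 + s) k"
    using assms by (intro signed_coeff_pos) (auto simp: algebra_simps power2_eq_square)
  then show ?thesis by (simp add: signed_coeff_def)
qed

end
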